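(* Let $T>0$, $T_1\in(0,T)$, $\gamma>0$, let $\Delta_h\in\mathbb{R}^{m\times m}$ be the discrete Laplacian with homogeneous Dirichlet boundary conditions, let $f,g\in L^2(0,T;\mathbb{R}^m)$ and $y_0\in\mathbb{R}^m$. Let $(y,p):[0,T]\to\mathbb{R}^m\times\mathbb{R}^m$ be the solution of the semi-discretized optimality system $$-\partial_t y+\Delta_h y-p/\gamma=f,\quad \partial_t p+\Delta_h p+y=g\ \text{ on }(0,T),\qquad y(0)=y_0,\quad p(T)=0.$$ Given arbitrary initial guesses $y_1^0(T_1),p_2^0(T_1)\in\mathbb{R}^m$, let the iterates of the additive Schwarz algorithm without overlap (ASN) be defined for $k=1,2,\dots$ as the solutions of $$\left\{\begin{array}{ll} -\partial_t y_1^k+\Delta_h y_1^k-p_1^k/\gamma=f & \text{on }(0,T_1),\quad y_1^k(0)=y_0,\\ \partial_t p_1^k+\Delta_h p_1^k+y_1^k=g & \text{on }(0,T_1),\quad p_1^k(T_1)=p_2^{k-1}(T_1), \end{array}\right.$$ $$\left\{\begin{array}{ll} -\partial_t y_2^k+\Delta_h y_2^k-p_2^k/\gamma=f & \text{on }(T_1,T),\quad y_2^k(T_1)=y_1^{k-1}(T_1),\\ \partial_t p_2^k+\Delta_h p_2^k+y_2^k=g & \text{on }(T_1,T),\quad p_2^k(T)=0. \end{array}\right.$$ Then the ASN algorithm is convergent: for any initial guess, as $k\to\infty$, $y_1^k(t)\to y(t)$ and $p_1^k(t)\to p(t)$ for every $t\in[0,T_1]$, and $y_2^k(t)\to y(t)$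 and $p_2^k(t)\to p(t)$ for every $t\in[T_1,T]$.
   Context: The spatial domain is $\Omega=(0,1)^d$, $d\in\{1,2,3\}$, with a uniform grid of mesh size $h=1/M$, $M\ge2$ an integer, and $m=(M-1)^d$ interior grid points. $\Delta_h$ is the matrix, acting on vectors of interior grid values, of the standard second-order central difference Laplacian ($(\Delta_h Z)_i=h^{-2}\sum_{j\sim i}(Z_j-Z_i)$, the sum being over the $2d$ nearest grid neighbours $j$ of the interior point $i$, with $Z_j=0$ at boundary points); for $d=2$ this is the 5-point stencil. Time is kept continuous. Solutions of the ODE systems are absolutely continuous vector functions on the respective closed time intervals satisfying the equations almost everywhere; the global system and the subdomain systems are understood to be uniquely solvable. *)

theory Defs
  imports "HOL-Analysis.Analysis"
begin

text \<open>Grid points of the uniform mesh on $(0,1)^d$ are represented by their integer coordinates: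
  \<open>q\<close> stands for the point $h\,q$ with $h = 1/M$. The index type \<open>'n\<close> labels the interior
  points through a bijection \<open>pos\<close> onto \<open>interior_points M\<close>, which forces
  \<open>CARD('n) = (M - 1) ^ CARD('d)\<close> and makes \<open>real ^ 'n\<close> the space of interior grid values.\<close>

definition interior_points :: "nat \<Rightarrow> (int ^ 'd::finite) set" where
  "interior_points M = {q. \<forall>k. 0 < q $ k \<and> q $ k < int M}"

definition nearest_neighbours :: "int ^ 'd::finite \<Rightarrow> (int ^ 'd) set" where
  "nearest_neighbours q = (\<Union>k. {q + axis k 1, q - axis k 1})"

text \<open>Homogeneous Dirichlet data: grid values are extended by zero to non-interior points.\<close>

definition grid_value :: "('n::finite \<Rightarrow> int ^ 'd::finite) \<Rightarrow> real ^ 'n \<Rightarrow> int ^ 'd \<Rightarrow> real" where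
  "grid_value pos Z q = (if q \<in> range pos then Z $ (inv pos q) else 0)"

definition discrete_laplacian ::
    "nat \<Rightarrow> ('n::finite \<Rightarrow> int ^ 'd::finite) \<Rightarrow> real ^ 'n ^ 'n" where
  "discrete_laplacian M pos =
     (let h = 1 / real M in
      matrix (\<lambda>Z. \<chi> i. (\<Sum>q\<in>nearest_neighbours (pos i). grid_value pos Z q - Z $ i) / h\<^sup>2))"

lemma discrete_laplacian_mult_nth:
  fixes pos :: "'n::finite \<Rightarrow> int ^ 'd::finite"
  shows "(discrete_laplacian M pos *v Z) $ i =
    (\<Sum>q\<in>nearest_neighbours (pos i). grid_value pos Z q - Z $ i) / (1 / real M)\<^sup>2"
proof -
  define F where "F = (\<lambda>Z :: real ^ 'n.
    \<chi> i. (\<Sum>q\<in>nearest_neighbours (pos i). grid_value pos Z q - Z $ i) / (1 / real M)\<^sup>2)"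
  have ga: "grid_value pos (x + y) q = grid_value pos x q + grid_value pos y q" for x y q
    by (simp add: grid_value_def)
  have gs: "grid_value pos (c *s x) q = c * grid_value pos x q" for c x q
    by (simp add: grid_value_def)
  have "Vector_Spaces.linear (*s) (*s) F"
  proof
    show "F (x + y) = F x + F y" for x y
      by (simp add: F_def vec_eq_iff ga add_diff_add sum.distrib add_divide_distrib)
    show "F (c *s x) = c *s F x" for c x
      by (simp add: F_def vec_eq_iff gs right_diff_distrib [symmetric] sum_distrib_left [symmetric])
  qed
  then have "matrix F *v Z = F Z"
    by (rule matrix_works)
  then show ?thesis
    by (simp add: discrete_laplacian_def Let_def F_def)
qed

text \<open>Members of a division are compact intervals with pairwise disjoint interiors, so this is the
  usual $\varepsilon$-$\delta$ condition. It is unrelated to the library's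
  \<open>absolutely_continuous\<close>, which is about measures.\<close>

definition absolutely_continuous_fun ::
    "real \<Rightarrow> real \<Rightarrow> (real \<Rightarrow> 'a::real_normed_vector) \<Rightarrow> bool" where
  "absolutely_continuous_fun a b u \<longleftrightarrow>
     (\<forall>e>0. \<exists>d>0. \<forall>D S. D division_of S \<and> S \<subseteq> {a..b} \<and> (\<Sum>K\<in>D. Sup K - Inf K) < d \<longrightarrow>
        (\<Sum>K\<in>D. norm (u (Sup K) - u (Inf K))) < e)"

definition square_integrable_on ::
    "(real \<Rightarrow> 'a::euclidean_space) \<Rightarrow> real set \<Rightarrow> bool" (infix \<open>square'_integrable'_on\<close> 46) where
  "u square_integrable_on S \<longleftrightarrow>
     u \<in> borel_measurable (lebesgue_on S) \<and> integrable (lebesgue_on S) (\<lambda>t. (norm (u t))\<^sup>2)"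

text \<open>The coupled equations on $(a,b)$ without initial and final conditions; \<open>A\<close> is the spatial
  operator.\<close>

definition optimality_system ::
    "real ^ 'n ^ 'n \<Rightarrow> real \<Rightarrow> (real \<Rightarrow> real ^ 'n) \<Rightarrow> (real \<Rightarrow> real ^ 'n) \<Rightarrow> real \<Rightarrow> real \<Rightarrow>
     (real \<Rightarrow> real ^ 'n) \<Rightarrow> (real \<Rightarrow> real ^ 'n::finite) \<Rightarrow> bool" where
  "optimality_system A \<gamma> f g a b y p \<longleftrightarrow>
     absolutely_continuous_fun a b y \<and> absolutely_continuous_fun a b p \<and>
     (AE t in lebesgue_on {a<..<b}. \<exists>y' p'.
        (y has_vector_derivative y') (at t) \<and> (p has_vector_derivative p') (at t) \<and>
        - y' + A *v y t - p t /\<^sub>R \<gamma> = f t \<and>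
        p' + A *v p t + y t = g t)"

text \<open>Step 0 carries only the initial guesses \<open>y1 0 T1\<close> and \<open>p2 0 T1\<close>; its other values
  are irrelevant.\<close>

definition ASN_iterates ::
    "real ^ 'n ^ 'n \<Rightarrow> real \<Rightarrow> (real \<Rightarrow> real ^ 'n) \<Rightarrow> (real \<Rightarrow> real ^ 'n) \<Rightarrow> real \<Rightarrow> real \<Rightarrow>
     real ^ 'n \<Rightarrow> real ^ 'n \<Rightarrow> real ^ 'n \<Rightarrow>
     (nat \<Rightarrow> real \<Rightarrow> real ^ 'n) \<Rightarrow> (nat \<Rightarrow> real \<Rightarrow> real ^ 'n) \<Rightarrow>
     (nat \<Rightarrow> real \<Rightarrow> real ^ 'n) \<Rightarrow> (nat \<Rightarrow> real \<Rightarrow> real ^ 'n::finite) \<Rightarrow> bool" where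
  "ASN_iterates A \<gamma> f g T1 T y0 y_guess p_guess y1 p1 y2 p2 \<longleftrightarrow>
     y1 0 T1 = y_guess \<and> p2 0 T1 = p_guess \<and>
     (\<forall>k\<ge>1.
        optimality_system A \<gamma> f g 0 T1 (y1 k) (p1 k) \<and>
        y1 k 0 = y0 \<and> p1 k T1 = p2 (k - 1) T1 \<and>
        optimality_system A \<gamma> f g T1 T (y2 k) (p2 k) \<and>
        y2 k T1 = y1 (k - 1) T1 \<and> p2 k T = 0)"

end

theory Submission
  imports Defs
begin

text \<open>
  The errors $(Y, P)$ solve the homogeneous system $Y' = A Y - P/\<gamma>$, $P' = -A P - Y$ with $A = \Delta_h$
  negative semidefinite. Along such solutions $|Y|^2 - |P|^2/\<gamma>$ is nonincreasing, so on $(0,T_1)$, where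
  $Y(0) = 0$, one has $|Y(T_1)|^2 \<le> |P(T_1)|^2/\<gamma> - |P(0)|^2/\<gamma>$, while Gronwall's inequality for
  $|Y|^2 + |P|^2/\<gamma>$ bounds $|P(0)|^2$ from below by a fixed fraction of $|P(T_1)|^2$. Hence the transfer
  $P(T_1) \<mapsto> Y(T_1)$ is a strict contraction in the weighted norms. On $(T_1,T)$ the same argument
  applies to $Y(T_1) \<mapsto> P(T_1)$. The interface errors therefore decay geometrically, and Gronwall's
  inequality extends this to all times. The data $f$, $g$ cancel in the integrated equations, so the
  errors are continuously differentiable although the solutions are only absolutely continuous.
\<close>

section \<open>The fundamental theorem of calculus for absolutely continuous functions\<close>

lemma absolutely_continuous_fun_subinterval:
  assumes "absolutely_continuous_fun a b u" and "a \<le> c" and "d \<le> b"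
  shows "absolutely_continuous_fun c d u"
proof -
  have sub: "S \<subseteq> {a..b}" if "S \<subseteq> {c..d}" for S
    using that assms(2,3) by force
  show ?thesis
    using assms(1) sub unfolding absolutely_continuous_fun_def by meson
qed

text \<open>The intervals of a partial division do not overlap, so their total length is the measure
  of their union. If they lie in a set \<open>G\<close> of measure below \<open>d\<close>, the
  length condition of absolute continuity is therefore met.\<close>

lemma absolutely_continuous_fun_tagged_sum:
  assumes ac: "\<And>D S. D division_of S \<Longrightarrow> S \<subseteq> {a..b} \<Longrightarrow> (\<Sum>K\<in>D. Sup K - Inf K) < d \<Longrightarrow>
      (\<Sum>K\<in>D. norm (u (Sup K) - u (Inf K))) < e"
    and p: "p tagged_partial_division_of {a..b}"
    and G: "(\<Union>(snd ` p)) \<subseteq> G" "G \<in> lmeasurable" "measure lebesgue G < d"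
  shows "(\<Sum>(x, K)\<in>p. norm (u (Sup K) - u (Inf K))) < e"
proof -
  note pd = tagged_partial_division_of_Union_self[OF p]
  note div = division_of_tagged_division[OF pd]
  have len: "Sup K - Inf K = measure lebesgue K" if "K \<in> snd ` p" for K
  proof -
    from division_ofD(3,4)[OF div that] obtain s t where "K = {s..t}" "s \<le> t"
      by (auto simp: cbox_interval)
    then show ?thesis by simp
  qed
  have "(\<Sum>K\<in>snd ` p. Sup K - Inf K) = measure lebesgue (\<Union>(snd ` p))"
    using content_division[OF div] len by simp
  also have "\<dots> \<le> measure lebesgue G"
    using G lmeasurable_division[OF div] by (intro measure_mono_fmeasurable) auto
  finally have lt: "(\<Sum>K\<in>snd ` p. Sup K - Inf K) < d"
    using G(3) by simp
  have sub: "\<Union>(snd ` p) \<subseteq> {a..b}"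
    using tagged_partial_division_ofD(3)[OF p] by force
  \<comment> \<open>Passing from tagged pairs to intervals is safe only if the summand vanishes on
    every interval with empty interior, since such an interval may carry several tags. For a single
    point this is automatic; for the empty set, \<open>Sup\<close> and \<open>Inf\<close> say
    nothing, so the value 0 is imposed.\<close>
  let ?n = "\<lambda>K. if K = {} then 0 else norm (u (Sup K) - u (Inf K))"
  have "(\<Sum>(x, K)\<in>p. norm (u (Sup K) - u (Inf K))) = (\<Sum>(x, K)\<in>p. ?n K)"
    using tagged_partial_division_ofD(2)[OF p] by (intro sum.cong) fastforce+
  also have "\<dots> = (\<Sum>K\<in>snd ` p. ?n K)"
    by (rule sum.over_tagged_division_lemma[OF pd]) (auto simp: cbox_interval box_real)
  also have "\<dots> = (\<Sum>K\<in>snd ` p. norm (u (Sup K) - u (Inf K)))"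
    using division_ofD(3)[OF div] by (intro sum.cong) auto
  also have "\<dots> < e"
    by (rule ac[OF div sub lt])
  finally show ?thesis .
qed

text \<open>At tags in the null set the gauge forces the intervals into an open set of small measure, where
  absolute continuity controls the increments of \<open>u\<close>; at the other tags the usual straddle estimate
  applies.\<close>

theorem absolutely_continuous_fun_has_integral:
  fixes u :: "real \<Rightarrow> 'a::banach"
  assumes ab: "a \<le> b" and ac: "absolutely_continuous_fun a b u" and N: "negligible N"
    and der: "\<And>x. x \<in> {a..b} - N \<Longrightarrow> (u has_vector_derivative v x) (at x within {a..b})"
  shows "(v has_integral u b - u a) {a..b}"
proof -
  \<comment> \<open>With integrand 0 on \<open>N\<close>, a piece tagged in \<open>N\<close>
    contributes only its increment of \<open>u\<close> to the error. The final spike over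
    \<open>N\<close> restores \<open>v\<close>.\<close>
  let ?w = "\<lambda>x. if x \<in> N then 0 else v x"
  have "(?w has_integral u b - u a) {a..b}"
    unfolding has_integral_real
  proof (intro allI impI)
    fix e :: real
    assume e: "e > 0"
    \<comment> \<open>Half of \<open>e\<close> pays for the straddle errors and half for the tags in
      \<open>N\<close>. The summand 1 keeps the denominator positive when
      \<open>a = b\<close>.\<close>
    define \<epsilon> where "\<epsilon> = e / (2 * (b - a + 1))"
    have \<epsilon>: "\<epsilon> > 0" "\<epsilon> * (b - a) \<le> e / 2"
      using e ab by (auto simp: \<epsilon>_def field_simps)
    have "\<forall>x. \<exists>\<delta>>0. x \<in> {a..b} - N \<longrightarrow>
        (\<forall>y\<in>{a..b}. norm (y - x) < \<delta> \<longrightarrow> norm (u y - u x - (y - x) *\<^sub>R v x) \<le> \<epsilon> * norm (y - x))"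
      using der \<epsilon>(1) unfolding has_vector_derivative_def has_derivative_within_alt by (meson zero_less_one)
    then obtain \<delta> where \<delta>: "\<And>x. 0 < \<delta> x"
      "\<And>x y. x \<in> {a..b} - N \<Longrightarrow> y \<in> {a..b} \<Longrightarrow> norm (y - x) < \<delta> x \<Longrightarrow>
         norm (u y - u x - (y - x) *\<^sub>R v x) \<le> \<epsilon> * norm (y - x)"
      by metis
    from ac e obtain d where d: "d > 0"
      "\<And>D S. D division_of S \<Longrightarrow> S \<subseteq> {a..b} \<Longrightarrow> (\<Sum>K\<in>D. Sup K - Inf K) < d \<Longrightarrow>
        (\<Sum>K\<in>D. norm (u (Sup K) - u (Inf K))) < e / 2"
      unfolding absolutely_continuous_fun_def by (metis half_gt_zero)
    have Nnull: "N \<in> null_sets lebesgue"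
      using N by (simp add: negligible_iff_null_sets)
    \<comment> \<open>Outer regularity bounds only \<open>G - N\<close>; since \<open>N\<close> is
      null, \<open>G\<close> itself has measure below \<open>d\<close>.\<close>
    then obtain G where G: "open G" "N \<subseteq> G" "G - N \<in> lmeasurable" "emeasure lebesgue (G - N) < ennreal d"
      using sets_lebesgue_outer_open[of N d] d(1) by blast
    have Gm: "G \<in> lmeasurable"
      using G(2,3) N by (metis Diff_partition fmeasurable.Un negligible_iff_measure)
    have "measure lebesgue G = measure lebesgue (G - N)"
      using Nnull Gm by (simp add: measure_Diff_null_set fmeasurableD)
    also have "\<dots> < d"
      using G(3,4) d(1) by (simp add: emeasure_eq_measure2 ennreal_less_iff)
    finally have Gd: "measure lebesgue G < d" .
    define \<Gamma> where "\<Gamma> x = (if x \<in> N then G else ball x (\<delta> x))" for x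
    have "gauge \<Gamma>"
      using G(1,2) \<delta>(1) by (auto simp: gauge_def \<Gamma>_def)
    moreover have "norm ((\<Sum>(x, K)\<in>p. measure lborel K *\<^sub>R ?w x) - (u b - u a)) < e"
      if p: "p tagged_division_of {a..b}" and fine: "\<Gamma> fine p" for p
    proof -
      define A where "A = {z \<in> p. fst z \<in> N}"
      have finp: "finite p" using p by blast
      have A: "A \<subseteq> p" "finite A" using finp by (auto simp: A_def)
      let ?t = "\<lambda>z. case z of (x, K) \<Rightarrow> measure lborel K *\<^sub>R ?w x - (u (Sup K) - u (Inf K))"
      have "A tagged_partial_division_of {a..b}"
        using p A(1) by (auto simp: tagged_division_of_def intro: tagged_partial_division_subset)
      moreover have "\<Union>(snd ` A) \<subseteq> G"
        using fine by (force simp: A_def fine_def \<Gamma>_def)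
      ultimately have "(\<Sum>(x, K)\<in>A. norm (u (Sup K) - u (Inf K))) < e / 2"
        using d(2) Gm Gd by (intro absolutely_continuous_fun_tagged_sum[of a b d u]) auto
      moreover have "norm (sum ?t A) \<le> (\<Sum>(x, K)\<in>A. norm (u (Sup K) - u (Inf K)))"
        by (rule sum_norm_le) (auto simp: A_def norm_minus_commute)
      ultimately have 1: "norm (sum ?t A) < e / 2" by linarith
      have tag: "norm (?t (x, K)) \<le> \<epsilon> * (Sup K - Inf K) \<and> 0 \<le> Sup K - Inf K" if "(x, K) \<in> p" "x \<notin> N" for x K
      proof -
        have "x \<in> K" and kab: "K \<subseteq> {a..b}"
          using p that(1) by blast+
        from tagged_division_ofD(4)[OF p that(1)] obtain s t where k: "K = {s..t}"
          by (auto simp: cbox_interval)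
        have "s \<le> t" using \<open>x \<in> K\<close> k by auto
        have near: "norm (z - x) < \<delta> x" if "z \<in> K" for z
          using fine \<open>(x, K) \<in> p\<close> \<open>x \<notin> N\<close> that by (force simp: fine_def \<Gamma>_def dist_real_def)
        have st: "s \<in> K" "t \<in> K" using \<open>s \<le> t\<close> k by auto
        \<comment> \<open>The increment over \<open>K\<close> is split at the tag \<open>x\<close>.
          As \<open>x\<close> lies between \<open>s\<close> and \<open>t\<close>, the two distances
          to it add up to \<open>t - s\<close>.\<close>
        have "norm ((t - s) *\<^sub>R v x - (u t - u s))
            = norm (u s - u x - (s - x) *\<^sub>R v x - (u t - u x - (t - x) *\<^sub>R v x))"
          by (auto simp: algebra_simps)
        also have "\<dots> \<le> norm (u s - u x - (s - x) *\<^sub>R v x) + norm (u t - u x - (t - x) *\<^sub>R v x)"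
          by (rule norm_triangle_ineq4)
        also have "\<dots> \<le> \<epsilon> * norm (s - x) + \<epsilon> * norm (t - x)"
          using \<open>x \<in> K\<close> \<open>x \<notin> N\<close> kab st near by (intro add_mono \<delta>(2)) auto
        also have "\<dots> = \<epsilon> * (t - s)"
          using \<open>x \<in> K\<close> by (auto simp: k field_simps)
        finally show ?thesis using \<open>s \<le> t\<close> \<open>x \<notin> N\<close> by (simp add: k)
      qed
      have "norm (sum ?t (p - A)) \<le> (\<Sum>(x, K)\<in>p - A. \<epsilon> * (Sup K - Inf K))"
        using tag by (intro sum_norm_le) (auto simp: A_def)
      \<comment> \<open>Adding the nonnegative terms tagged in \<open>N\<close> completes the
        division, whose lengths then telescope to \<open>b - a\<close>.\<close>
      also have "\<dots> \<le> (\<Sum>(x, K)\<in>p. \<epsilon> * (Sup K - Inf K))"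
      proof (rule sum_mono2[OF finp])
        show "0 \<le> (case z of (x, K) \<Rightarrow> \<epsilon> * (Sup K - Inf K))" if z: "z \<in> p - (p - A)" for z
        proof -
          obtain x K where xk: "z = (x, K)" by force
          then have "x \<in> K" using p z by blast
          moreover obtain s t where "K = cbox s t"
            using tagged_division_ofD(4)[OF p] z xk by blast
          ultimately show ?thesis using \<epsilon>(1) xk by (simp add: cbox_interval)
        qed
      qed auto
      also have "\<dots> = \<epsilon> * (b - a)"
        using additive_tagged_division_1[OF ab p, of "\<lambda>x. x"]
        by (simp add: split_def sum_distrib_left[symmetric])
      finally have 2: "norm (sum ?t (p - A)) \<le> e / 2" using \<epsilon>(2) by linarith
      have "(\<Sum>(x, K)\<in>p. measure lborel K *\<^sub>R ?w x) - (u b - u a) = sum ?t p"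
        using additive_tagged_division_1[OF ab p, of u] by (simp add: split_def sum_subtractf)
      also have "\<dots> = sum ?t (p - A) + sum ?t A"
        by (rule sum.subset_diff[OF A(1) finp])
      finally have split: "(\<Sum>(x, K)\<in>p. measure lborel K *\<^sub>R ?w x) - (u b - u a)
          = sum ?t (p - A) + sum ?t A" .
      show ?thesis
        unfolding split by (rule le_less_trans[OF norm_triangle_ineq]) (use 1 2 in linarith)
    qed
    ultimately show "\<exists>\<Gamma>. gauge \<Gamma> \<and> (\<forall>p. p tagged_division_of {a..b} \<and> \<Gamma> fine p \<longrightarrow>
        norm ((\<Sum>(x, K)\<in>p. measure lborel K *\<^sub>R ?w x) - (u b - u a)) < e)"
      by (intro exI[of _ \<Gamma>]) simp
  qed
  then show ?thesis
    by (rule has_integral_spike[OF N, rotated]) simp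
qed

section \<open>The homogeneous system and its energies\<close>

lemma optimality_system_subinterval:
  assumes sys: "optimality_system A \<gamma> f g a b y p" and "a \<le> c" and "d \<le> b"
  shows "optimality_system A \<gamma> f g c d y p"
proof -
  have "{c<..<d} \<subseteq> {a<..<b}" using assms(2,3) by auto
  with assms show ?thesis
    unfolding optimality_system_def
    by (auto intro: absolutely_continuous_fun_subinterval simp: AE_restrict_space_iff elim!: eventually_mono)
qed

text \<open>Integrated form of the equations. Absolute continuity enters here: without it, equations
  holding almost everywhere would not determine the increments of \<open>y\<close> and
  \<open>p\<close>.\<close>

lemma optimality_system_has_integral:
  assumes sys: "optimality_system A \<gamma> f g a b y p" and t: "t \<in> {a..b}"
  shows "((\<lambda>s. A *v y s - p s /\<^sub>R \<gamma> - f s) has_integral y t - y a) {a..t}"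
    and "((\<lambda>s. g s - A *v p s - y s) has_integral p t - p a) {a..t}"
proof -
  have sys': "optimality_system A \<gamma> f g a t y p"
    using sys t by (auto intro: optimality_system_subinterval)
  then have ac: "absolutely_continuous_fun a t y" "absolutely_continuous_fun a t p"
    unfolding optimality_system_def by auto
  let ?eqs = "\<lambda>s. \<exists>y' p'. (y has_vector_derivative y') (at s) \<and>
      (p has_vector_derivative p') (at s) \<and> - y' + A *v y s - p s /\<^sub>R \<gamma> = f s \<and> p' + A *v p s + y s = g s"
  have "AE s in lebesgue_on {a<..<t}. ?eqs s"
    using sys' unfolding optimality_system_def by blast
  then have "AE s in lebesgue. s \<in> {a<..<t} \<longrightarrow> ?eqs s"
    by (subst (asm) AE_restrict_space_iff) simp_all
  then obtain N where N: "negligible N" "{s. \<not> (s \<in> {a<..<t} \<longrightarrow> ?eqs s)} \<subseteq> N"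
    unfolding eventually_ae_filter_negligible by blast
  \<comment> \<open>The equations are given on the open interval only, so the endpoints join the
    exceptional set.\<close>
  let ?N = "N \<union> {a, t}"
  have negl: "negligible ?N" using N(1) by simp
  have der: "(y has_vector_derivative A *v y s - p s /\<^sub>R \<gamma> - f s) (at s within {a..t}) \<and>
      (p has_vector_derivative g s - A *v p s - y s) (at s within {a..t})" if "s \<in> {a..t} - ?N" for s
  proof -
    from that obtain y' p' where "(y has_vector_derivative y') (at s)" "(p has_vector_derivative p') (at s)"
      and eqs: "- y' + A *v y s - p s /\<^sub>R \<gamma> = f s" "p' + A *v p s + y s = g s"
      using N(2) by force
    moreover have "y' = A *v y s - p s /\<^sub>R \<gamma> - f s" "p' = g s - A *v p s - y s"
      using eqs by (simp_all add: algebra_simps flip: eqs)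
    ultimately show ?thesis
      by (auto intro: has_vector_derivative_at_within)
  qed
  have at: "a \<le> t" using t by simp
  show "((\<lambda>s. A *v y s - p s /\<^sub>R \<gamma> - f s) has_integral y t - y a) {a..t}"
    by (rule absolutely_continuous_fun_has_integral[OF at ac(1) negl]) (use der in blast)
  show "((\<lambda>s. g s - A *v p s - y s) has_integral p t - p a) {a..t}"
    by (rule absolutely_continuous_fun_has_integral[OF at ac(2) negl]) (use der in blast)
qed

lemma has_integral_imp_continuous_on:
  fixes u :: "real \<Rightarrow> 'a::banach"
  assumes "\<And>t. t \<in> {a..b} \<Longrightarrow> (v has_integral u t - u a) {a..t}"
  shows "continuous_on {a..b} u"
proof (cases "a \<le> b")
  case True
  then have "v integrable_on {a..b}"
    using assms[of b] by (auto simp: has_integral_integrable)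
  then have "continuous_on {a..b} (\<lambda>t. u a + integral {a..t} v)"
    by (intro continuous_intros indefinite_integral_continuous_1)
  then show ?thesis
    by (rule continuous_on_eq) (simp add: integral_unique[OF assms])
qed simp

lemma has_integral_imp_has_vector_derivative:
  fixes u :: "real \<Rightarrow> 'a::banach"
  assumes int: "\<And>t. t \<in> {a..b} \<Longrightarrow> (v has_integral u t - u a) {a..t}"
    and v: "continuous_on {a..b} v" and t: "t \<in> {a..b}"
  shows "(u has_vector_derivative v t) (at t within {a..b})"
proof -
  have "((\<lambda>t. u a + integral {a..t} v) has_vector_derivative v t) (at t within {a..b})"
    using has_vector_derivative_add[OF has_vector_derivative_const integral_has_vector_derivative[OF v t]]
    by simp
  then show ?thesis
    by (rule has_vector_derivative_transform[OF t, rotated]) (simp add: integral_unique[OF int])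
qed

definition homogeneous_system ::
    "real ^ 'n ^ 'n \<Rightarrow> real \<Rightarrow> real \<Rightarrow> real \<Rightarrow> (real \<Rightarrow> real ^ 'n) \<Rightarrow> (real \<Rightarrow> real ^ 'n::finite) \<Rightarrow> bool" where
  "homogeneous_system A \<gamma> a b y p \<longleftrightarrow> (\<forall>t\<in>{a..b}.
     (y has_vector_derivative A *v y t - p t /\<^sub>R \<gamma>) (at t within {a..b}) \<and>
     (p has_vector_derivative - (A *v p t) - y t) (at t within {a..b}))"

lemma continuous_on_matrix_vector_mult:
  fixes u :: "'a::topological_space \<Rightarrow> real ^ 'n::finite"
  assumes "continuous_on S u"
  shows "continuous_on S (\<lambda>t. A *v u t)"
  using assms by (rule bounded_linear.continuous_on[OF matrix_vector_mul_bounded_linear])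

text \<open>Regularity is gained in two rounds. After \<open>f\<close> and \<open>g\<close> cancel
  in the integral identities, the differences have integrands that are linear in themselves. As
  indefinite integrals the differences are continuous, so the integrands are continuous too, and the
  differences are differentiable at every point.\<close>

lemma optimality_system_diff:
  assumes 1: "optimality_system A \<gamma> f g a b y p" and 2: "optimality_system A \<gamma> f g a b y' p'"
  shows "homogeneous_system A \<gamma> a b (\<lambda>t. y t - y' t) (\<lambda>t. p t - p' t)"
proof -
  note I1 = optimality_system_has_integral[OF 1] and I2 = optimality_system_has_integral[OF 2]
  let ?y = "\<lambda>t. y t - y' t" and ?p = "\<lambda>t. p t - p' t"
  have cont: "continuous_on {a..b} ?y" "continuous_on {a..b} ?p"
    using has_integral_imp_continuous_on[OF I1(1)] has_integral_imp_continuous_on[OF I2(1)]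
      has_integral_imp_continuous_on[OF I1(2)] has_integral_imp_continuous_on[OF I2(2)]
    by (auto intro!: continuous_intros)
  have "((\<lambda>s. A *v ?y s - ?p s /\<^sub>R \<gamma>) has_integral ?y t - ?y a) {a..t}"
    "((\<lambda>s. - (A *v ?p s) - ?y s) has_integral ?p t - ?p a) {a..t}" if "t \<in> {a..b}" for t
    using has_integral_diff[OF I1(1)[OF that] I2(1)[OF that]]
      has_integral_diff[OF I1(2)[OF that] I2(2)[OF that]]
    by (simp_all add: matrix_vector_mult_diff_distrib algebra_simps)
  then show ?thesis
    unfolding homogeneous_system_def
    by (intro ballI conjI has_integral_imp_has_vector_derivative)
      (auto intro!: continuous_intros continuous_on_matrix_vector_mult cont)
qed

section \<open>Energy estimates for the homogeneous system\<close>

lemma derivative_within_nonpos_imp_antimono: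
  fixes F :: "real \<Rightarrow> real"
  assumes "\<And>t. t \<in> {a..b} \<Longrightarrow> (F has_real_derivative F' t) (at t within {a..b})"
    and "\<And>t. t \<in> {a..b} \<Longrightarrow> F' t \<le> 0" and st: "a \<le> s" "s \<le> t" "t \<le> b"
  shows "F t \<le> F s"
proof (cases "s < t")
  case True
  have "continuous_on {a..b} F"
    by (rule DERIV_continuous_on) (rule assms(1))
  then have "continuous_on {s..t} F"
    by (rule continuous_on_subset) (use assms in auto)
  moreover have "(F has_real_derivative F' x) (at x)" "F' x \<le> 0" if "s < x" "x < t" for x
    using assms(1)[of x] assms(2)[of x] st that at_within_Icc_at[of a x b] by auto
  ultimately show ?thesis
    by (intro DERIV_nonpos_imp_decreasing_open[OF st(2)]) blast+
qed (use st in simp)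

text \<open>A bound for the logarithmic rate of change of |y|^2 + |p|^2/\<gamma>, in either
  direction of time. The first term comes from \<open>A\<close> acting on both components, the
  second from the coupling.\<close>

definition energy_rate :: "real ^ 'n ^ 'n \<Rightarrow> real \<Rightarrow> real" where
  "energy_rate A \<gamma> = 2 * onorm (\<lambda>x. A *v x) + 2 / sqrt \<gamma>"

lemma energy_rate_pos:
  fixes A :: "real ^ 'n::finite ^ 'n"
  shows "\<gamma> > 0 \<Longrightarrow> energy_rate A \<gamma> > 0"
  unfolding energy_rate_def
  by (intro add_nonneg_pos) (auto simp: onorm_pos_le[OF matrix_vector_mul_bounded_linear])

lemma norm_sq_derivative:
  fixes u :: "real \<Rightarrow> 'a::real_inner"
  assumes "(u has_vector_derivative u') (at t within S)"
  shows "((\<lambda>t. (norm (u t))\<^sup>2) has_real_derivative 2 * (u t \<bullet> u')) (at t within S)"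
  using bounded_bilinear.has_vector_derivative[OF bounded_bilinear_inner assms assms]
  by (simp add: power2_norm_eq_inner has_real_derivative_iff_has_vector_derivative inner_commute)

text \<open>The coupling terms cancel in the derivative of this indefinite energy, leaving only
  the dissipation of \<open>A\<close> in both components.\<close>

lemma homogeneous_system_energy_decreasing:
  assumes sys: "homogeneous_system A \<gamma> a b y p" and nsd: "\<And>z. z \<bullet> (A *v z) \<le> 0" and \<gamma>: "\<gamma> > 0"
    and st: "a \<le> s" "s \<le> t" "t \<le> b"
  shows "(norm (y t))\<^sup>2 - (norm (p t))\<^sup>2 / \<gamma> \<le> (norm (y s))\<^sup>2 - (norm (p s))\<^sup>2 / \<gamma>"
proof (rule derivative_within_nonpos_imp_antimono[OF _ _ st])
  let ?D = "\<lambda>t. 2 * (y t \<bullet> (A *v y t - p t /\<^sub>R \<gamma>)) - 2 * (p t \<bullet> (- (A *v p t) - y t)) / \<gamma>"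
  fix t
  assume t: "t \<in> {a..b}"
  show "((\<lambda>t. (norm (y t))\<^sup>2 - (norm (p t))\<^sup>2 / \<gamma>) has_real_derivative ?D t) (at t within {a..b})"
    using sys t unfolding homogeneous_system_def
    by (intro DERIV_diff DERIV_cdivide norm_sq_derivative) auto
  have "?D t = 2 * (y t \<bullet> (A *v y t)) + 2 * (p t \<bullet> (A *v p t)) / \<gamma>"
    using \<gamma> by (simp add: inner_diff_right inner_commute field_simps)
  also have "\<dots> \<le> 0"
    using nsd \<gamma> by (simp add: add_nonpos_nonpos divide_nonpos_pos)
  finally show "?D t \<le> 0" .
qed

text \<open>The derivative of \<open>E\<close> is at most \<open>energy_rate A \<gamma>\<close>
  times \<open>E\<close> in absolute value, so \<open>E\<close> can neither grow nor decay faster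
  than exponentially. The forward bound serves the subdomain with zero initial state, the backward
  bound the one with zero final adjoint.\<close>

lemma homogeneous_system_gronwall:
  assumes sys: "homogeneous_system A \<gamma> a b y p" and \<gamma>: "\<gamma> > 0"
    and st: "a \<le> s" "s \<le> t" "t \<le> b"
  defines "E \<equiv> \<lambda>t. (norm (y t))\<^sup>2 + (norm (p t))\<^sup>2 / \<gamma>"
  shows "E t \<le> exp (energy_rate A \<gamma> * (t - s)) * E s"
    and "E s \<le> exp (energy_rate A \<gamma> * (t - s)) * E t"
proof -
  let ?D = "\<lambda>t. 2 * (y t \<bullet> (A *v y t - p t /\<^sub>R \<gamma>)) + 2 * (p t \<bullet> (- (A *v p t) - y t)) / \<gamma>"
  let ?K = "energy_rate A \<gamma>" and ?L = "onorm (\<lambda>x. A *v x)"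
  have der: "(E has_real_derivative ?D t) (at t within {a..b})" if "t \<in> {a..b}" for t
    using sys that unfolding homogeneous_system_def E_def
    by (intro DERIV_add DERIV_cdivide norm_sq_derivative) auto
  have quad: "\<bar>z \<bullet> (A *v z)\<bar> \<le> ?L * (norm z)\<^sup>2" for z
  proof -
    have "\<bar>z \<bullet> (A *v z)\<bar> \<le> norm z * norm (A *v z)"
      by (rule Cauchy_Schwarz_ineq2)
    also have "\<dots> \<le> norm z * (?L * norm z)"
      by (intro mult_left_mono onorm matrix_vector_mul_bounded_linear) auto
    finally show ?thesis by (simp add: power2_eq_square algebra_simps)
  qed
  have bound: "\<bar>?D t\<bar> \<le> ?K * E t" for t
  proof -
    let ?r = "sqrt \<gamma>"
    have r: "?r > 0" "\<gamma> = ?r\<^sup>2" using \<gamma> by auto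
    \<comment> \<open>Young's inequality is applied to |y| and |p|/sqrt \<gamma>, whose squares are
      exactly the two terms of \<open>E\<close>.\<close>
    have "2 * \<bar>y t \<bullet> p t\<bar> \<le> 2 * (norm (y t) * norm (p t))"
      using Cauchy_Schwarz_ineq2[of "y t" "p t"] by simp
    also have "\<dots> = ?r * (2 * norm (y t) * (norm (p t) / ?r))"
      using r(1) by simp
    also have "\<dots> \<le> ?r * ((norm (y t))\<^sup>2 + (norm (p t) / ?r)\<^sup>2)"
      using sum_squares_bound[of "norm (y t)" "norm (p t) / ?r"] r(1) by (intro mult_left_mono) auto
    also have "\<dots> = ?r * E t"
      using \<gamma> by (simp add: E_def power_divide)
    finally have "2 / \<gamma> * (2 * \<bar>y t \<bullet> p t\<bar>) \<le> 2 / \<gamma> * (?r * E t)"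
      using \<gamma> by (intro mult_left_mono) auto
    also have "\<dots> = 2 / ?r * E t"
      using r(1) by (simp add: divide_simps)
    finally have mixed: "4 * \<bar>y t \<bullet> p t\<bar> / \<gamma> \<le> 2 / ?r * E t"
      by simp
    have "?D t = 2 * (y t \<bullet> (A *v y t)) - 2 * (p t \<bullet> (A *v p t)) / \<gamma> - 4 * (y t \<bullet> p t) / \<gamma>"
      using \<gamma> by (simp add: inner_diff_right inner_commute field_simps)
    then have "\<bar>?D t\<bar> \<le> \<bar>2 * (y t \<bullet> (A *v y t))\<bar> + \<bar>2 * (p t \<bullet> (A *v p t)) / \<gamma>\<bar> + \<bar>4 * (y t \<bullet> p t) / \<gamma>\<bar>"
      by linarith
    also have "\<dots> = 2 * \<bar>y t \<bullet> (A *v y t)\<bar> + 2 * \<bar>p t \<bullet> (A *v p t)\<bar> / \<gamma> + 4 * \<bar>y t \<bullet> p t\<bar> / \<gamma>"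
      using \<gamma> by (simp add: abs_mult)
    also have "\<dots> \<le> 2 * (?L * (norm (y t))\<^sup>2) + 2 * (?L * (norm (p t))\<^sup>2) / \<gamma> + 2 / ?r * E t"
      using quad[of "y t"] quad[of "p t"] \<gamma> by (intro add_mono mult_left_mono divide_right_mono mixed) auto
    also have "\<dots> = ?K * E t"
      unfolding energy_rate_def E_def by (simp add: algebra_simps)
    finally show ?thesis .
  qed
  have "exp (- ?K * t) * E t \<le> exp (- ?K * s) * E s"
  proof (rule derivative_within_nonpos_imp_antimono[OF _ _ st])
    fix t
    assume t: "t \<in> {a..b}"
    show "((\<lambda>t. exp (- ?K * t) * E t) has_real_derivative exp (- ?K * t) * (?D t - ?K * E t)) (at t within {a..b})"
      by (rule derivative_eq_intros der[OF t] refl | simp add: algebra_simps)+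
    show "exp (- ?K * t) * (?D t - ?K * E t) \<le> 0"
      using bound[of t] by (intro mult_nonneg_nonpos) auto
  qed
  then have "exp (?K * t) * (exp (- ?K * t) * E t) \<le> exp (?K * t) * (exp (- ?K * s) * E s)"
    by (rule mult_left_mono) simp
  moreover have "exp (?K * t) * (exp (- ?K * t) * E t) = E t"
    by (simp add: exp_minus)
  moreover have "exp (?K * t) * (exp (- ?K * s) * E s) = exp (?K * (t - s)) * E s"
    by (simp add: exp_minus exp_diff right_diff_distrib divide_inverse)
  ultimately show "E t \<le> exp (?K * (t - s)) * E s"
    by (simp only:)
  \<comment> \<open>The function exp(Kt) E(t) is nondecreasing; the minus sign fits it to the lemma
    on nonincreasing functions.\<close>
  have "- (exp (?K * t) * E t) \<le> - (exp (?K * s) * E s)"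
  proof (rule derivative_within_nonpos_imp_antimono[OF _ _ st])
    fix t
    assume t: "t \<in> {a..b}"
    show "((\<lambda>t. - (exp (?K * t) * E t)) has_real_derivative - (exp (?K * t) * (?D t + ?K * E t))) (at t within {a..b})"
      by (rule derivative_eq_intros der[OF t] refl | simp add: algebra_simps)+
    show "- (exp (?K * t) * (?D t + ?K * E t)) \<le> 0"
      using bound[of t] by simp
  qed
  then have "exp (- ?K * s) * (exp (?K * s) * E s) \<le> exp (- ?K * s) * (exp (?K * t) * E t)"
    by (intro mult_left_mono) auto
  moreover have "exp (- ?K * s) * (exp (?K * s) * E s) = E s"
    by (simp add: exp_minus)
  moreover have "exp (- ?K * s) * (exp (?K * t) * E t) = exp (?K * (t - s)) * E t"
    by (simp add: exp_minus exp_diff right_diff_distrib divide_inverse)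
  ultimately show "E s \<le> exp (?K * (t - s)) * E t"
    by (simp only:)
qed

section \<open>Contraction at the interface\<close>

text \<open>Write e(t) for |p(t)|^2/\<gamma>. The indefinite energy starts at -e(a), which gives
  |y(b)|^2 \<le> e(b) - e(a). Gronwall gives e(a) \<ge> exp(-K(b-a)) e(b), so a fixed fraction of
  e(b) is lost. The second claim controls the whole trajectory by the datum prescribed at
  \<open>b\<close>.\<close>

lemma homogeneous_system_contraction_zero_initial:
  assumes sys: "homogeneous_system A \<gamma> a b y p" and nsd: "\<And>z. z \<bullet> (A *v z) \<le> 0" and \<gamma>: "\<gamma> > 0"
    and ab: "a \<le> b" and y: "y a = 0"
  defines "K \<equiv> energy_rate A \<gamma>"
  shows "(norm (y b))\<^sup>2 \<le> (1 - exp (- K * (b - a))) * ((norm (p b))\<^sup>2 / \<gamma>)"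
    and "t \<in> {a..b} \<Longrightarrow> (norm (y t))\<^sup>2 + (norm (p t))\<^sup>2 / \<gamma> \<le> exp (K * (b - a)) * ((norm (p b))\<^sup>2 / \<gamma>)"
proof -
  let ?e = "(norm (p a))\<^sup>2 / \<gamma>"
  have decr: "(norm (y b))\<^sup>2 - (norm (p b))\<^sup>2 / \<gamma> \<le> - ?e"
    using homogeneous_system_energy_decreasing[OF sys nsd \<gamma> order_refl ab order_refl] y by simp
  have "(norm (y b))\<^sup>2 + (norm (p b))\<^sup>2 / \<gamma> \<le> exp (K * (b - a)) * ?e"
    using homogeneous_system_gronwall(1)[OF sys \<gamma> order_refl ab order_refl] y by (simp add: K_def)
  then have "(norm (p b))\<^sup>2 / \<gamma> \<le> exp (K * (b - a)) * ?e"
    using zero_le_power2[of "norm (y b)"] by linarith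
  then have "exp (- K * (b - a)) * ((norm (p b))\<^sup>2 / \<gamma>) \<le> exp (- K * (b - a)) * (exp (K * (b - a)) * ?e)"
    by (intro mult_left_mono) auto
  also have "\<dots> = ?e"
    by (simp add: mult.assoc[symmetric] exp_add[symmetric] del: times_divide_eq_right)
  finally show "(norm (y b))\<^sup>2 \<le> (1 - exp (- K * (b - a))) * ((norm (p b))\<^sup>2 / \<gamma>)"
    using decr unfolding left_diff_distrib by linarith
  \<comment> \<open>Gronwall starts from \<open>a\<close>, where only \<open>p\<close> is nonzero;
    this inequality replaces that unknown value by the datum at \<open>b\<close>.\<close>
  have e: "?e \<le> (norm (p b))\<^sup>2 / \<gamma>"
    using decr zero_le_power2[of "norm (y b)"] by linarith
  assume t: "t \<in> {a..b}"
  have "(norm (y t))\<^sup>2 + (norm (p t))\<^sup>2 / \<gamma> \<le> exp (K * (t - a)) * ?e"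
    using homogeneous_system_gronwall(1)[OF sys \<gamma> order_refl, of t] t y by (simp add: K_def)
  also have "\<dots> \<le> exp (K * (b - a)) * ((norm (p b))\<^sup>2 / \<gamma>)"
    using t \<gamma> energy_rate_pos[OF \<gamma>, of A] by (intro mult_mono e) (auto simp: K_def)
  finally show "(norm (y t))\<^sup>2 + (norm (p t))\<^sup>2 / \<gamma> \<le> exp (K * (b - a)) * ((norm (p b))\<^sup>2 / \<gamma>)" .
qed

text \<open>Mirror image of the preceding lemma. The indefinite energy ends at |y(b)|^2, and the
  Gronwall bound run backward from \<open>b\<close> keeps that value above a fixed fraction of
  |y(a)|^2.\<close>

lemma homogeneous_system_contraction_zero_final:
  assumes sys: "homogeneous_system A \<gamma> a b y p" and nsd: "\<And>z. z \<bullet> (A *v z) \<le> 0" and \<gamma>: "\<gamma> > 0"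
    and ab: "a \<le> b" and p: "p b = 0"
  defines "K \<equiv> energy_rate A \<gamma>"
  shows "(norm (p a))\<^sup>2 / \<gamma> \<le> (1 - exp (- K * (b - a))) * (norm (y a))\<^sup>2"
    and "t \<in> {a..b} \<Longrightarrow> (norm (y t))\<^sup>2 + (norm (p t))\<^sup>2 / \<gamma> \<le> exp (K * (b - a)) * (norm (y a))\<^sup>2"
proof -
  let ?e = "(norm (y b))\<^sup>2"
  have decr: "?e \<le> (norm (y a))\<^sup>2 - (norm (p a))\<^sup>2 / \<gamma>"
    using homogeneous_system_energy_decreasing[OF sys nsd \<gamma> order_refl ab order_refl] p by simp
  have pa: "0 \<le> (norm (p a))\<^sup>2 / \<gamma>"
    using \<gamma> by simp
  have "(norm (y a))\<^sup>2 + (norm (p a))\<^sup>2 / \<gamma> \<le> exp (K * (b - a)) * ?e"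
    using homogeneous_system_gronwall(2)[OF sys \<gamma> order_refl ab order_refl] p by (simp add: K_def)
  then have "(norm (y a))\<^sup>2 \<le> exp (K * (b - a)) * ?e"
    using pa by linarith
  then have "exp (- K * (b - a)) * (norm (y a))\<^sup>2 \<le> exp (- K * (b - a)) * (exp (K * (b - a)) * ?e)"
    by (intro mult_left_mono) auto
  also have "\<dots> = ?e"
    by (simp add: mult.assoc[symmetric] exp_add[symmetric])
  finally show "(norm (p a))\<^sup>2 / \<gamma> \<le> (1 - exp (- K * (b - a))) * (norm (y a))\<^sup>2"
    using decr unfolding left_diff_distrib by linarith
  have e: "?e \<le> (norm (y a))\<^sup>2"
    using decr pa by linarith
  assume t: "t \<in> {a..b}"
  have "(norm (y t))\<^sup>2 + (norm (p t))\<^sup>2 / \<gamma> \<le> exp (K * (b - t)) * ?e"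
    using homogeneous_system_gronwall(2)[OF sys \<gamma> _ _ order_refl, of t] t p by (simp add: K_def)
  also have "\<dots> \<le> exp (K * (b - a)) * (norm (y a))\<^sup>2"
    using t energy_rate_pos[OF \<gamma>, of A] by (intro mult_mono e) (auto simp: K_def)
  finally show "(norm (y t))\<^sup>2 + (norm (p t))\<^sup>2 / \<gamma> \<le> exp (K * (b - a)) * (norm (y a))\<^sup>2" .
qed

section \<open>Geometric convergence of the iterates\<close>

text \<open>The bound is asked for from index 1 on, because step 0 of the algorithm is constrained
  only at the interface.\<close>

lemma LIMSEQ_norm_power2_bound:
  fixes x :: "nat \<Rightarrow> 'a::real_normed_vector"
  assumes "B \<longlonglongrightarrow> 0" and "\<And>k. (norm (x (Suc k) - l))\<^sup>2 \<le> B k"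
  shows "x \<longlonglongrightarrow> l"
proof -
  have "(\<lambda>k. (norm (x (Suc k) - l))\<^sup>2) \<longlonglongrightarrow> 0"
    using assms(2) by (intro real_tendsto_sandwich[OF _ _ tendsto_const assms(1)]) auto
  then have "(\<lambda>k. sqrt ((norm (x (Suc k) - l))\<^sup>2)) \<longlonglongrightarrow> sqrt 0"
    by (rule tendsto_real_sqrt)
  then have "(\<lambda>k. norm (x (Suc k) - l)) \<longlonglongrightarrow> 0"
    by simp
  then have "(\<lambda>k. x (Suc k) - l) \<longlonglongrightarrow> 0"
    by (rule tendsto_norm_zero_cancel)
  then have "(\<lambda>k. x (Suc k)) \<longlonglongrightarrow> l"
    by (rule LIM_zero_cancel)
  then show ?thesis
    by (rule LIMSEQ_imp_Suc[of x])
qed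

text \<open>Negative semidefiniteness is all that the argument uses of the spatial operator. Each
  subdomain solve turns one interface error into the other and shrinks it.\<close>

theorem ASN_convergent:
  fixes A :: "real ^ 'n::finite ^ 'n"
  assumes nsd: "\<And>z. z \<bullet> (A *v z) \<le> 0" and T1: "T1 \<in> {0<..<T}" and \<gamma>: "\<gamma> > 0"
    and sys: "optimality_system A \<gamma> f g 0 T y p" and y0: "y 0 = y0" and pT: "p T = 0"
    and iter: "ASN_iterates A \<gamma> f g T1 T y0 y_guess p_guess y1 p1 y2 p2"
  shows "t \<in> {0..T1} \<Longrightarrow> (\<lambda>k. y1 k t) \<longlonglongrightarrow> y t" and "t \<in> {0..T1} \<Longrightarrow> (\<lambda>k. p1 k t) \<longlonglongrightarrow> p t"
    and "t \<in> {T1..T} \<Longrightarrow> (\<lambda>k. y2 k t) \<longlonglongrightarrow> y t" and "t \<in> {T1..T} \<Longrightarrow> (\<lambda>k. p2 k t) \<longlonglongrightarrow> p t"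
proof -
  define K where "K = energy_rate A \<gamma>"
  \<comment> \<open>Both constants are formed with the full length \<open>T\<close>, so that they
    serve the two subintervals at once.\<close>
  define \<theta> where "\<theta> = 1 - exp (- K * T)"
  define C where "C = exp (K * T)"
  define Y where "Y k = (norm (y1 k T1 - y T1))\<^sup>2" for k
  define P where "P k = (norm (p2 k T1 - p T1))\<^sup>2 / \<gamma>" for k
  have T: "0 \<le> T1" "T1 \<le> T" "0 < T" using T1 by auto
  have K: "K > 0" using energy_rate_pos[OF \<gamma>] by (simp add: K_def)
  have \<theta>: "0 \<le> \<theta>" "\<theta> < 1" using K T by (auto simp: \<theta>_def)
  have nonneg: "0 \<le> Y k" "0 \<le> P k" for k using \<gamma> by (auto simp: Y_def P_def)
  have \<theta>_mono: "1 - exp (- K * s) \<le> \<theta>" if "s \<le> T" for s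
    using that K by (simp add: \<theta>_def)
  have C_mono: "exp (K * s) \<le> C" if "s \<le> T" for s
    using that K by (simp add: C_def)
  have it: "optimality_system A \<gamma> f g 0 T1 (y1 (Suc k)) (p1 (Suc k))" "y1 (Suc k) 0 = y0"
      "p1 (Suc k) T1 = p2 k T1"
      "optimality_system A \<gamma> f g T1 T (y2 (Suc k)) (p2 (Suc k))"
      "y2 (Suc k) T1 = y1 k T1" "p2 (Suc k) T = 0" for k
    using iter unfolding ASN_iterates_def by (auto dest: spec[of _ "Suc k"])
  have sys1: "homogeneous_system A \<gamma> 0 T1 (\<lambda>t. y1 (Suc k) t - y t) (\<lambda>t. p1 (Suc k) t - p t)" for k
    using T by (intro optimality_system_diff[OF it(1)] optimality_system_subinterval[OF sys]) auto
  have sys2: "homogeneous_system A \<gamma> T1 T (\<lambda>t. y2 (Suc k) t - y t) (\<lambda>t. p2 (Suc k) t - p t)" for k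
    using T by (intro optimality_system_diff[OF it(4)] optimality_system_subinterval[OF sys]) auto
  note c1 = homogeneous_system_contraction_zero_initial[OF sys1 nsd \<gamma> T(1), folded K_def]
  note c2 = homogeneous_system_contraction_zero_final[OF sys2 nsd \<gamma> T(2), folded K_def]
  have Y_Suc: "Y (Suc k) \<le> \<theta> * P k" for k
  proof -
    have "Y (Suc k) \<le> (1 - exp (- K * (T1 - 0))) * P k"
      using c1(1)[of k] by (simp add: it y0 Y_def P_def)
    also have "\<dots> \<le> \<theta> * P k"
      using T nonneg by (intro mult_right_mono \<theta>_mono) auto
    finally show ?thesis .
  qed
  have P_Suc: "P (Suc k) \<le> \<theta> * Y k" for k
  proof -
    have "P (Suc k) \<le> (1 - exp (- K * (T - T1))) * Y k"
      using c2(1)[of k] by (simp add: it pT Y_def P_def)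
    also have "\<dots> \<le> \<theta> * Y k"
      using T nonneg by (intro mult_right_mono \<theta>_mono) auto
    finally show ?thesis .
  qed
  \<comment> \<open>Each new error is bounded by the other old one, since both subdomains use data
    from the previous step. Adding the two bounds closes the recursion.\<close>
  have geometric: "Y k + P k \<le> \<theta> ^ k * (Y 0 + P 0)" for k
  proof (induction k)
    case (Suc k)
    have "Y (Suc k) + P (Suc k) \<le> \<theta> * (Y k + P k)"
      using Y_Suc[of k] P_Suc[of k] by (simp add: algebra_simps)
    also have "\<dots> \<le> \<theta> * (\<theta> ^ k * (Y 0 + P 0))"
      using Suc \<theta>(1) by (rule mult_left_mono)
    finally show ?case by (simp add: mult.assoc)
  qed simp
  let ?B = "\<lambda>k. C * (\<theta> ^ k * (Y 0 + P 0))"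
  have "(\<lambda>k. \<theta> ^ k) \<longlonglongrightarrow> 0"
    using \<theta> by (intro LIMSEQ_power_zero) simp
  then have B: "?B \<longlonglongrightarrow> 0"
    by (intro tendsto_mult_right_zero tendsto_mult_left_zero)
  have C: "C > 0" by (simp add: C_def)
  \<comment> \<open>Iterate \<open>Suc k\<close> is driven by the interface error of step
    \<open>k\<close>, hence the exponent \<open>k\<close>. The constant \<open>C\<close> is the
    price for leaving the interface.\<close>
  have bound1: "(norm (y1 (Suc k) t - y t))\<^sup>2 + (norm (p1 (Suc k) t - p t))\<^sup>2 / \<gamma> \<le> ?B k"
    if t: "t \<in> {0..T1}" for k t
  proof -
    have "(norm (y1 (Suc k) t - y t))\<^sup>2 + (norm (p1 (Suc k) t - p t))\<^sup>2 / \<gamma> \<le> exp (K * (T1 - 0)) * P k"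
      using c1(2)[of k t] t by (simp add: it y0 P_def)
    also have "\<dots> \<le> C * (Y k + P k)"
      using T nonneg by (intro mult_mono C_mono) (auto simp: C_def)
    also have "\<dots> \<le> ?B k"
      using geometric C by (intro mult_left_mono) auto
    finally show ?thesis .
  qed
  have bound2: "(norm (y2 (Suc k) t - y t))\<^sup>2 + (norm (p2 (Suc k) t - p t))\<^sup>2 / \<gamma> \<le> ?B k"
    if t: "t \<in> {T1..T}" for k t
  proof -
    have "(norm (y2 (Suc k) t - y t))\<^sup>2 + (norm (p2 (Suc k) t - p t))\<^sup>2 / \<gamma> \<le> exp (K * (T - T1)) * Y k"
      using c2(2)[of k t] t by (simp add: it pT Y_def)
    also have "\<dots> \<le> C * (Y k + P k)"
      using T nonneg by (intro mult_mono C_mono) (auto simp: C_def)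
    also have "\<dots> \<le> ?B k"
      using geometric C by (intro mult_left_mono) auto
    finally show ?thesis .
  qed
  have lim: "u \<longlonglongrightarrow> l \<and> w \<longlonglongrightarrow> m"
    if "\<And>k. (norm (u (Suc k) - l))\<^sup>2 + (norm (w (Suc k) - m))\<^sup>2 / \<gamma> \<le> ?B k"
    for u w :: "nat \<Rightarrow> real ^ 'n" and l m
  proof
    have "(norm (u (Suc k) - l))\<^sup>2 \<le> ?B k" for k
      by (rule order_trans[OF _ that]) (use \<gamma> in simp)
    then show "u \<longlonglongrightarrow> l" by (rule LIMSEQ_norm_power2_bound[OF B])
    have "(norm (w (Suc k) - m))\<^sup>2 \<le> \<gamma> * ?B k" for k
    proof -
      have "(norm (w (Suc k) - m))\<^sup>2 / \<gamma> \<le> ?B k"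
        using that[of k] zero_le_power2[of "norm (u (Suc k) - l)"] by linarith
      then show ?thesis
        using \<gamma> by (simp add: pos_divide_le_eq mult.commute)
    qed
    then show "w \<longlonglongrightarrow> m"
      by (rule LIMSEQ_norm_power2_bound[OF tendsto_mult_right_zero[OF B]])
  qed
  show "(\<lambda>k. y1 k t) \<longlonglongrightarrow> y t" "(\<lambda>k. p1 k t) \<longlonglongrightarrow> p t" if "t \<in> {0..T1}"
    using lim[OF bound1[OF that]] by auto
  show "(\<lambda>k. y2 k t) \<longlonglongrightarrow> y t" "(\<lambda>k. p2 k t) \<longlonglongrightarrow> p t" if "t \<in> {T1..T}"
    using lim[OF bound2[OF that]] by auto
qed

section \<open>Negative semidefiniteness of the discrete Laplacian\<close>

lemma finite_nearest_neighbours: "finite (nearest_neighbours q)"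
  by (simp add: nearest_neighbours_def)

lemma nearest_neighbours_sym: "q \<in> nearest_neighbours r \<longleftrightarrow> r \<in> nearest_neighbours q"
  unfolding nearest_neighbours_def by (auto simp: algebra_simps)

text \<open>From (b - a)^2 \<ge> 0 one gets 2a(b - a) \<le> b^2 - a^2 for each grid point with value
  a and each of its neighbours with value b. Summed over all such pairs, contributions between
  points of the grid cancel by symmetry, while a neighbour outside the grid has b = 0 and leaves
  -a^2.\<close>

lemma discrete_laplacian_nonpos:
  fixes pos :: "'n::finite \<Rightarrow> int ^ 'd::finite"
  assumes pos: "inj pos"
  shows "Z \<bullet> (discrete_laplacian M pos *v Z) \<le> 0"
proof -
  let ?nn = "\<lambda>i. nearest_neighbours (pos i)" and ?z = "grid_value pos Z"
  have z_pos: "?z (pos i) = Z $ i" for i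
    using pos by (simp add: grid_value_def)
  \<comment> \<open>Neighbours outside the range of \<open>pos\<close> carry the value 0, so the sum
    may run over grid indices; this prepares the exchange of summations.\<close>
  have count: "(\<Sum>q\<in>?nn i. (?z q)\<^sup>2) = (\<Sum>j\<in>UNIV. if pos j \<in> ?nn i then (Z $ j)\<^sup>2 else 0)" for i
  proof -
    have "(\<Sum>q\<in>?nn i. (?z q)\<^sup>2) = (\<Sum>q\<in>pos ` {j. pos j \<in> ?nn i}. (?z q)\<^sup>2)"
      by (rule sum.mono_neutral_right) (auto simp: finite_nearest_neighbours grid_value_def)
    also have "\<dots> = (\<Sum>j | pos j \<in> ?nn i. (Z $ j)\<^sup>2)"
      using pos by (subst sum.reindex) (auto simp: z_pos inj_on_def)
    also have "\<dots> = (\<Sum>j\<in>UNIV. if pos j \<in> ?nn i then (Z $ j)\<^sup>2 else 0)"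
      by (simp add: sum.If_cases)
    finally show ?thesis .
  qed
  have "(\<Sum>i\<in>UNIV. \<Sum>q\<in>?nn i. (?z q)\<^sup>2)
      = (\<Sum>j\<in>UNIV. \<Sum>i\<in>UNIV. if pos j \<in> ?nn i then (Z $ j)\<^sup>2 else 0)"
    unfolding count by (rule sum.swap)
  \<comment> \<open>By symmetry of the neighbour relation, the square at \<open>j\<close> is counted
    once per neighbour of \<open>j\<close> in the grid, hence at most once per neighbour.\<close>
  also have "\<dots> \<le> (\<Sum>j\<in>UNIV. \<Sum>q\<in>?nn j. (Z $ j)\<^sup>2)"
  proof (rule sum_mono)
    fix j
    have "(\<Sum>i\<in>UNIV. if pos j \<in> ?nn i then (Z $ j)\<^sup>2 else 0) = (\<Sum>i | pos i \<in> ?nn j. (Z $ j)\<^sup>2)"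
      by (simp add: sum.If_cases nearest_neighbours_sym[of "pos j"])
    also have "\<dots> = (\<Sum>q\<in>pos ` {i. pos i \<in> ?nn j}. (Z $ j)\<^sup>2)"
      using pos by (subst sum.reindex) (auto simp: inj_on_def)
    also have "\<dots> \<le> (\<Sum>q\<in>?nn j. (Z $ j)\<^sup>2)"
      by (rule sum_mono2) (auto simp: finite_nearest_neighbours)
    finally show "(\<Sum>i\<in>UNIV. if pos j \<in> ?nn i then (Z $ j)\<^sup>2 else 0) \<le> (\<Sum>q\<in>?nn j. (Z $ j)\<^sup>2)" .
  qed
  finally have swap: "(\<Sum>i\<in>UNIV. \<Sum>q\<in>?nn i. (?z q)\<^sup>2) \<le> (\<Sum>i\<in>UNIV. \<Sum>q\<in>?nn i. (Z $ i)\<^sup>2)" .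
  have "2 * (\<Sum>i\<in>UNIV. Z $ i * (\<Sum>q\<in>?nn i. ?z q - Z $ i))
      = (\<Sum>i\<in>UNIV. \<Sum>q\<in>?nn i. 2 * Z $ i * (?z q - Z $ i))"
    by (simp add: sum_distrib_left mult.assoc)
  also have "\<dots> \<le> (\<Sum>i\<in>UNIV. \<Sum>q\<in>?nn i. (?z q)\<^sup>2 - (Z $ i)\<^sup>2)"
  proof (intro sum_mono)
    fix i q
    show "2 * Z $ i * (?z q - Z $ i) \<le> (?z q)\<^sup>2 - (Z $ i)\<^sup>2"
      using zero_le_power2[of "?z q - Z $ i"] by (simp add: power2_eq_square algebra_simps)
  qed
  also have "\<dots> \<le> 0"
    using swap by (simp add: sum_subtractf)
  finally have "(\<Sum>i\<in>UNIV. Z $ i * (\<Sum>q\<in>?nn i. ?z q - Z $ i)) \<le> 0"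
    by simp
  moreover have "Z \<bullet> (discrete_laplacian M pos *v Z)
      = (\<Sum>i\<in>UNIV. Z $ i * (\<Sum>q\<in>?nn i. ?z q - Z $ i)) / (1 / real M)\<^sup>2"
    by (simp add: inner_vec_def discrete_laplacian_mult_nth sum_divide_distrib[of _ UNIV])
  ultimately show ?thesis
    by (simp add: divide_nonpos_nonneg)
qed

theorem theorem4p1:
  fixes M :: nat
    and pos :: "'n::finite \<Rightarrow> int ^ 'd::finite"
    and T T1 \<gamma> :: real
    and f g y p :: "real \<Rightarrow> real ^ 'n"
    and y0 y_guess p_guess :: "real ^ 'n"
    and y1 p1 y2 p2 :: "nat \<Rightarrow> real \<Rightarrow> real ^ 'n"
  assumes "CARD('d) \<in> {1, 2, 3}"
    and "M \<ge> 2"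
    and "bij_betw pos UNIV (interior_points M)"
    and "T > 0" and "T1 \<in> {0<..<T}" and "\<gamma> > 0"
    and "f square_integrable_on {0<..<T}" and "g square_integrable_on {0<..<T}"
    and "optimality_system (discrete_laplacian M pos) \<gamma> f g 0 T y p"
    and "y 0 = y0" and "p T = 0"
    and "ASN_iterates (discrete_laplacian M pos) \<gamma> f g T1 T y0 y_guess p_guess y1 p1 y2 p2"
  shows "(\<forall>t\<in>{0..T1}. (\<lambda>k. y1 k t) \<longlonglongrightarrow> y t \<and> (\<lambda>k. p1 k t) \<longlonglongrightarrow> p t) \<and>
         (\<forall>t\<in>{T1..T}. (\<lambda>k. y2 k t) \<longlonglongrightarrow> y t \<and> (\<lambda>k. p2 k t) \<longlonglongrightarrow> p t)"
proof -
  have "inj pos"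
    using \<open>bij_betw pos UNIV (interior_points M)\<close> by (rule bij_betw_imp_inj_on)
  then have nsd: "z \<bullet> (discrete_laplacian M pos *v z) \<le> 0" for z
    by (rule discrete_laplacian_nonpos)
  show ?thesis
    using ASN_convergent[OF nsd assms(5,6,9-12)] by auto
qed

end
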